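(* A Toeplitz-row graph of order $n$ is connected and triangle-free if and only if $n\ge 5$ and it is a path or a cycle of order $n$.
   Context: Write $[m]=\{1,\dots,m\}$. For disjoint subsets $\alpha,\beta\subseteq[n-1]$, not both empty (so $n\ge 2$), $T_n\langle\alpha;\beta\rangle$ denotes the $n\times n$ $(0,1)$-matrix $(t_{u,v})$ with $t_{u,v}=1$ if and only if $u-v\in\alpha$ or $v-u\in\beta$. The row graph $\mathrm{RG}(T)$ of an $n\times n$ $(0,1)$-matrix $T=(t_{u,v})$ is the simple graph with vertex set $[n]$ in which two distinct vertices $u,v$ are adjacent if and only if $t_{u,k}=t_{v,k}=1$ for some $k\in[n]$. A Toeplitz-row graph is a graph (isomorphic to one) of the form $\mathrm{RG}(T)$ for some $T=T_n\langle\alpha;\beta\rangle$. The order of a graph is its number of vertices. *)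

theory Defs
  imports "Graph_Theory.Graph_Theory"
begin

text \<open>
  Simple graphs on a vertex set are rendered as \<^locale>\<open>pair_graph\<close>: finite, loop-free, and with a
  symmetric set of arcs, where an edge between u and v is the pair of arcs (u, v), (v, u).
  An \<open>n \<times> n\<close> matrix is a function of a row and a column index, of which only the
  values at indices in \<open>{1..n}\<close> are relevant.
\<close>

definition toeplitz01 :: "nat set \<Rightarrow> nat set \<Rightarrow> nat \<Rightarrow> nat \<Rightarrow> nat" where
  "toeplitz01 \<alpha> \<beta> u v =
     (if int u - int v \<in> int ` \<alpha> \<or> int v - int u \<in> int ` \<beta> then 1 else 0)"

definition row_graph :: "nat \<Rightarrow> (nat \<Rightarrow> nat \<Rightarrow> nat) \<Rightarrow> nat pair_pre_digraph" where
  "row_graph n T =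
     \<lparr> pverts = {1..n},
       parcs = {(u, v). u \<in> {1..n} \<and> v \<in> {1..n} \<and> u \<noteq> v \<and> (\<exists>k\<in>{1..n}. T u k = 1 \<and> T v k = 1)} \<rparr>"

definition toeplitz_row_graph :: "'a pair_pre_digraph \<Rightarrow> bool" where
  "toeplitz_row_graph G \<longleftrightarrow>
     (\<exists>n \<alpha> \<beta>. \<alpha> \<subseteq> {1..n - 1} \<and> \<beta> \<subseteq> {1..n - 1} \<and> \<alpha> \<inter> \<beta> = {} \<and> \<not> (\<alpha> = {} \<and> \<beta> = {}) \<and>
        digraph_iso (with_proj G) (with_proj (row_graph n (toeplitz01 \<alpha> \<beta>))))"

definition triangle_free :: "'a pair_pre_digraph \<Rightarrow> bool" where
  "triangle_free G \<longleftrightarrow>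
     \<not> (\<exists>u v w. u \<noteq> v \<and> v \<noteq> w \<and> u \<noteq> w \<and> (u, v) \<in> parcs G \<and> (v, w) \<in> parcs G \<and> (u, w) \<in> parcs G)"

definition path_graph :: "nat \<Rightarrow> nat pair_pre_digraph" where
  "path_graph n =
     \<lparr> pverts = {1..n},
       parcs = {(u, v). u \<in> {1..n} \<and> v \<in> {1..n} \<and> (v = u + 1 \<or> u = v + 1)} \<rparr>"

text \<open>Only meant for \<open>n \<ge> 3\<close>; for smaller n this is not a cycle.\<close>

definition cycle_graph :: "nat \<Rightarrow> nat pair_pre_digraph" where
  "cycle_graph n =
     \<lparr> pverts = {1..n},
       parcs = parcs (path_graph n) \<union> {(n, 1), (1, n)} \<rparr>"

definition is_path_of_order :: "'a pair_pre_digraph \<Rightarrow> nat \<Rightarrow> bool" where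
  "is_path_of_order G n \<longleftrightarrow> n \<ge> 1 \<and> digraph_iso (with_proj G) (with_proj (path_graph n))"

definition is_cycle_of_order :: "'a pair_pre_digraph \<Rightarrow> nat \<Rightarrow> bool" where
  "is_cycle_of_order G n \<longleftrightarrow> n \<ge> 3 \<and> digraph_iso (with_proj G) (with_proj (cycle_graph n))"

lemma pair_graphI_simple:
  assumes "finite (pverts G)" "parcs G \<subseteq> pverts G \<times> pverts G" "sym (parcs G)"
    and "\<And>u. (u, u) \<notin> parcs G"
  shows "pair_graph G"
proof -
  have "finite (parcs G)"
    using assms(1,2) finite_subset by blast
  then show ?thesis
    using assms by unfold_locales (auto simp: symmetric_def)
qed

lemma pair_graph_row_graph: "pair_graph (row_graph n T)"
  by (rule pair_graphI_simple) (auto simp: row_graph_def intro!: symI)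

lemma pair_graph_path_graph: "pair_graph (path_graph n)"
  by (rule pair_graphI_simple) (auto simp: path_graph_def intro!: symI)

lemma pair_graph_cycle_graph: "n \<ge> 3 \<Longrightarrow> pair_graph (cycle_graph n)"
  by (rule pair_graphI_simple) (auto simp: cycle_graph_def path_graph_def intro!: symI)

end

theory Submission
  imports Defs
begin

text \<open>
  The rows that have a one in a given column form a clique of the row graph, so in a triangle-free
  row graph every column has at most two ones (\<open>card_col_support_le_two\<close>). A Toeplitz matrix is persymmetric, that is, symmetric about its
  antidiagonal (\<open>toeplitz01_persymmetric\<close>), so row \<open>u\<close> has as many ones as column \<open>n + 1 - u\<close>,
  and hence every row has at most two ones as well. Each one in row \<open>u\<close> contributes at most one
  neighbour, since its column contains at most one further one; therefore the row graph has
  maximum degree at most two (\<open>degree_le_card_row_support\<close>). A connected graph of maximum degree at most two is a path or a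
  cycle: a longest path covers all vertices, and the only edge that can exist besides those of the
  path joins its two ends (\<open>hamiltonian_path_if_degree_le_two\<close>,
  \<open>path_or_cycle_if_hamiltonian_path\<close>).

  It remains to exclude the orders below 5. The \<open>n - 1\<close> edges of a Hamiltonian path use pairwise
  different columns, so at least \<open>n - 1\<close> columns, and by persymmetry at least \<open>n - 1\<close> rows, have
  exactly two ones (\<open>many_full_columns\<close>). For \<open>n \<ge> 3\<close> some index \<open>k\<close> thus has both a row and a column with two ones.
  Disjointness of \<open>\<alpha>\<close> and \<open>\<beta>\<close> says that the entries at \<open>(k, j)\<close> and \<open>(j, k)\<close> are never both one,
  and the diagonal is zero; so these four ones lie at four different indices other than \<open>k\<close>,
  and \<open>4 \<le> n - 1\<close> (\<open>order_ge_five\<close>). The remaining case \<open>n = 2\<close> falls to the same count: a column with two ones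
  requires \<open>2 \<le> n - 1\<close>.

  Conversely, paths are triangle-free, cycles of length at least 4 are triangle-free, and both
  are connected.
\<close>

section \<open>Isomorphisms of graphs without parallel arcs\<close>

lemma pair_graph_imp_pair_wf_digraph: "pair_graph G \<Longrightarrow> pair_wf_digraph G"
  by (simp add: pair_graph_def pair_digraph_def pair_fin_digraph_def)

text \<open>
  An isomorphism of digraphs carries separate maps for vertices, arcs, heads and tails.
  Without parallel arcs the vertex map determines the others, which gives the usual
  notion of a graph isomorphism.
\<close>

lemma digraph_iso_with_proj_iff:
  assumes "pair_wf_digraph G" "pair_wf_digraph H"
  shows "digraph_iso (with_proj G) (with_proj H) \<longleftrightarrow>
    (\<exists>f. bij_betw f (pverts G) (pverts H) \<and>
         (\<forall>u\<in>pverts G. \<forall>v\<in>pverts G. (u, v) \<in> parcs G \<longleftrightarrow> (f u, f v) \<in> parcs H))"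
    (is "?L \<longleftrightarrow> ?R")
proof
  interpret G: pair_wf_digraph G by fact
  assume ?L
  then obtain h where h: "pre_digraph.digraph_isomorphism (with_proj G) h"
    and H: "with_proj H = app_iso h (with_proj G)"
    by (auto simp: digraph_iso_def)
  let ?f = "iso_verts h"
  have verts: "pverts H = ?f ` pverts G"
    using arg_cong[OF H, of verts] by simp
  have arcs: "parcs H = iso_arcs h ` parcs G"
    using arg_cong[OF H, of arcs] by simp
  have tail: "iso_tail h = fst" using arg_cong[OF H, of tail] by simp
  have head: "iso_head h = snd" using arg_cong[OF H, of head] by simp
  have inj: "inj_on ?f (pverts G)"
    using h by (simp add: pre_digraph.digraph_isomorphism_def)
  have iso_arcs: "iso_arcs h (u, v) = (?f u, ?f v)" if "(u, v) \<in> parcs G" for u v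
    using h that tail head
    by (auto simp: pre_digraph.digraph_isomorphism_def prod_eq_iff)
  have "(u, v) \<in> parcs G \<longleftrightarrow> (?f u, ?f v) \<in> parcs H"
    if uv: "u \<in> pverts G" "v \<in> pverts G" for u v
  proof
    assume "(u, v) \<in> parcs G"
    then show "(?f u, ?f v) \<in> parcs H" using arcs iso_arcs by (metis imageI)
  next
    assume "(?f u, ?f v) \<in> parcs H"
    then obtain x y where xy: "(x, y) \<in> parcs G" "(?f u, ?f v) = iso_arcs h (x, y)"
      using arcs by auto
    then have "?f u = ?f x" "?f v = ?f y" using iso_arcs by auto
    then have "u = x" "v = y"
      using inj uv G.wellformed'[OF xy(1)] by (auto dest: inj_onD)
    then show "(u, v) \<in> parcs G" using xy by simp
  qed
  then show ?R using inj verts by (auto simp: bij_betw_def intro!: exI[of _ ?f])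
next
  interpret G: pair_wf_digraph G by fact
  interpret H: pair_wf_digraph H by fact
  assume ?R
  then obtain f where bij: "bij_betw f (pverts G) (pverts H)"
    and iff: "\<And>u v. u \<in> pverts G \<Longrightarrow> v \<in> pverts G \<Longrightarrow> (u, v) \<in> parcs G \<longleftrightarrow> (f u, f v) \<in> parcs H"
    by blast
  define h where "h = \<lparr>iso_verts = f, iso_arcs = map_prod f f, iso_head = snd, iso_tail = fst\<rparr>"
  have inj: "inj_on f (pverts G)" and im: "f ` pverts G = pverts H"
    using bij by (auto simp: bij_betw_def)
  have sub: "parcs G \<subseteq> pverts G \<times> pverts G" by (auto dest: G.wellformed')
  have "inj_on (map_prod f f) (parcs G)"
    using map_prod_inj_on[OF inj inj] sub inj_on_subset by blast
  then have 1: "pre_digraph.digraph_isomorphism (with_proj G) h"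
    using inj G.wf_digraph_axioms by (auto simp: pre_digraph.digraph_isomorphism_def h_def)
  have "map_prod f f ` parcs G = parcs H"
  proof (intro equalityI subrelI)
    fix x y assume "(x, y) \<in> map_prod f f ` parcs G"
    then obtain u v where "(u, v) \<in> parcs G" "x = f u" "y = f v" by auto
    then show "(x, y) \<in> parcs H" using iff G.wellformed' by blast
  next
    fix x y assume xy: "(x, y) \<in> parcs H"
    then obtain u v where "u \<in> pverts G" "v \<in> pverts G" "x = f u" "y = f v"
      using H.wellformed'[OF xy] im by blast
    moreover from this have "(u, v) \<in> parcs G" using xy iff by blast
    ultimately show "(x, y) \<in> map_prod f f ` parcs G" by auto
  qed
  then have "with_proj H = app_iso h (with_proj G)"
    using im by (simp add: with_proj_def app_iso_def h_def)
  then show ?L using 1 by (auto simp: digraph_iso_def)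
qed

lemma digraph_iso_with_proj_sym:
  assumes "pair_wf_digraph G" "digraph_iso (with_proj G) (with_proj H)"
  shows "digraph_iso (with_proj H) (with_proj G)"
  using assms by (simp add: digraph_iso_swap wf_digraph_wp_iff)

lemma digraph_iso_with_proj_trans:
  assumes "pair_wf_digraph G" "pair_wf_digraph H" "pair_wf_digraph K"
    and "digraph_iso (with_proj G) (with_proj H)" "digraph_iso (with_proj H) (with_proj K)"
  shows "digraph_iso (with_proj G) (with_proj K)"
proof -
  obtain f where f: "bij_betw f (pverts G) (pverts H)"
    "\<forall>u\<in>pverts G. \<forall>v\<in>pverts G. (u, v) \<in> parcs G \<longleftrightarrow> (f u, f v) \<in> parcs H"
    using assms digraph_iso_with_proj_iff by metis
  obtain g where g: "bij_betw g (pverts H) (pverts K)"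
    "\<forall>u\<in>pverts H. \<forall>v\<in>pverts H. (u, v) \<in> parcs H \<longleftrightarrow> (g u, g v) \<in> parcs K"
    using assms digraph_iso_with_proj_iff by metis
  have "bij_betw (g \<circ> f) (pverts G) (pverts K)"
    using f g bij_betw_trans by blast
  moreover have "\<forall>u\<in>pverts G. \<forall>v\<in>pverts G.
      (u, v) \<in> parcs G \<longleftrightarrow> ((g \<circ> f) u, (g \<circ> f) v) \<in> parcs K"
    using f(2) g(2) bij_betw_apply[OF f(1)] by simp
  ultimately show ?thesis
    using assms(1,3) by (auto simp: digraph_iso_with_proj_iff)
qed

lemma connected_iso:
  assumes "pair_wf_digraph G" "digraph_iso (with_proj G) (with_proj H)"
    and "Digraph_Component.connected (with_proj G)"
  shows "Digraph_Component.connected (with_proj H)"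
  using assms wf_digraph.connectedI_app_iso[of "with_proj G"]
  by (auto simp: digraph_iso_def wf_digraph_wp_iff)

lemma triangle_free_iso:
  assumes wf: "pair_wf_digraph G" "pair_wf_digraph H"
    and iso: "digraph_iso (with_proj G) (with_proj H)" and "triangle_free H"
  shows "triangle_free G"
proof -
  interpret G: pair_wf_digraph G by fact
  obtain f where f: "inj_on f (pverts G)"
    "\<And>u v. u \<in> pverts G \<Longrightarrow> v \<in> pverts G \<Longrightarrow> (u, v) \<in> parcs G \<longleftrightarrow> (f u, f v) \<in> parcs H"
    using iso digraph_iso_with_proj_iff[OF wf] by (auto simp: bij_betw_def)
  show ?thesis
    unfolding triangle_free_def
  proof clarify
    fix u v w
    assume uvw: "u \<noteq> v" "v \<noteq> w" "u \<noteq> w" "(u, v) \<in> parcs G" "(v, w) \<in> parcs G" "(u, w) \<in> parcs G"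
    then have V: "u \<in> pverts G" "v \<in> pverts G" "w \<in> pverts G" using G.wellformed' by blast+
    then have "f u \<noteq> f v" "f v \<noteq> f w" "f u \<noteq> f w"
      using uvw f(1) by (auto dest: inj_onD)
    moreover have "(f u, f v) \<in> parcs H" "(f v, f w) \<in> parcs H" "(f u, f w) \<in> parcs H"
      using uvw V f(2) by blast+
    ultimately show False using \<open>triangle_free H\<close> unfolding triangle_free_def by blast
  qed
qed

section \<open>Paths and cycles\<close>

lemma connected_if_contains_path_graph:
  assumes G: "pair_graph G" and V: "pverts G = {1..n}" and n: "n \<ge> 1"
    and A: "parcs (path_graph n) \<subseteq> parcs G"
  shows "Digraph_Component.connected (with_proj G)"
proof -
  interpret pair_graph G by fact
  have step: "(i, Suc i) \<in> parcs G" if "1 \<le> i" "i < n" for i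
    using A that by (auto simp: path_graph_def)
  have from1: "reachable (with_proj G) 1 i" if "1 \<le> i" "i \<le> n" for i
    using that
  proof (induction i rule: nat_induct_at_least)
    case base
    then show ?case using V by auto
  next
    case (Suc i)
    then have "reachable (with_proj G) 1 i" "(i, Suc i) \<in> parcs G" using step by auto
    then show ?case using reachable_adj_trans by blast
  qed
  have "reachable (with_proj G) u v" if "u \<in> {1..n}" "v \<in> {1..n}" for u v
    using that from1 symmetric_reachable' reachable_trans by (meson atLeastAtMost_iff)
  then have "strongly_connected (with_proj G)"
    using V n by (intro strongly_connectedI) auto
  then show ?thesis
    using V n by (intro connectedI) (auto intro!: reachable_mk_symmetricI)
qed

lemma triangle_free_path_graph: "triangle_free (path_graph n)"
  unfolding triangle_free_def
proof clarify
  fix u v w :: nat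
  assume "(u, v) \<in> parcs (path_graph n)" "(v, w) \<in> parcs (path_graph n)"
    "(u, w) \<in> parcs (path_graph n)"
  then have "v = u + 1 \<or> u = v + 1" "w = v + 1 \<or> v = w + 1" "w = u + 1 \<or> u = w + 1"
    by (simp_all add: path_graph_def)
  then show False by linarith
qed

lemma triangle_free_cycle_graph:
  assumes "n \<ge> 4"
  shows "triangle_free (cycle_graph n)"
  unfolding triangle_free_def
proof clarify
  have arc: "v = u + 1 \<or> u = v + 1 \<or> u = 1 \<and> v = n \<or> u = n \<and> v = 1"
    if "(u, v) \<in> parcs (cycle_graph n)" for u v
    using that unfolding cycle_graph_def path_graph_def by simp blast
  fix u v w :: nat
  assume "u \<noteq> v" "v \<noteq> w" "u \<noteq> w"
    and "(u, v) \<in> parcs (cycle_graph n)" "(v, w) \<in> parcs (cycle_graph n)"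
    "(u, w) \<in> parcs (cycle_graph n)"
  then show False
    using arc[of u v] arc[of v w] arc[of u w] assms by linarith
qed

lemma connected_triangle_free_if_path_or_cycle:
  assumes G: "pair_graph G" and n: "n \<ge> 4"
    and or: "is_path_of_order G n \<or> is_cycle_of_order G n"
  shows "Digraph_Component.connected (with_proj G) \<and> triangle_free G"
proof -
  obtain H where H: "H = path_graph n \<or> H = cycle_graph n"
    and iso: "digraph_iso (with_proj G) (with_proj H)"
    using or by (auto simp: is_path_of_order_def is_cycle_of_order_def)
  have pg: "pair_graph H"
    using H n pair_graph_path_graph pair_graph_cycle_graph[of n] by auto
  have wf: "pair_wf_digraph G" "pair_wf_digraph H"
    using G pg pair_graph_imp_pair_wf_digraph by blast+
  have "Digraph_Component.connected (with_proj H)"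
    using H n by (intro connected_if_contains_path_graph[OF pg, of n])
      (auto simp: cycle_graph_def path_graph_def)
  moreover have "triangle_free H"
    using H n triangle_free_path_graph triangle_free_cycle_graph by auto
  ultimately show ?thesis
    using wf iso connected_iso digraph_iso_with_proj_sym triangle_free_iso by metis
qed

section \<open>Connected graphs of maximum degree two\<close>

lemma connected_arc_leaving:
  assumes G: "pair_graph G" and conn: "Digraph_Component.connected (with_proj G)"
    and S: "S \<subset> pverts G" "S \<noteq> {}"
  obtains u v where "u \<in> S" "v \<notin> S" "(u, v) \<in> parcs G"
proof -
  interpret pair_graph G by fact
  obtain x y where x: "x \<in> S" and y: "y \<in> pverts G" "y \<notin> S" using S by auto
  have "strongly_connected (with_proj G)"
    using symmetric_connected_imp_strongly_connected[OF pair_sym_arcs conn] .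
  then have "reachable (with_proj G) x y"
    using x y S by (auto simp: strongly_connected_def)
  then have "\<exists>u v. u \<in> S \<and> v \<notin> S \<and> (u, v) \<in> parcs G"
    using x y(2)
  proof (induction rule: converse_reachable_induct)
    case (step u v)
    then show ?case by auto
  qed auto
  then show ?thesis using that by blast
qed

lemma (in pair_graph) at_most_two_neighbours:
  assumes "card (parcs G `` {u}) \<le> 2"
    and "(u, a) \<in> parcs G" "(u, b) \<in> parcs G" "(u, c) \<in> parcs G"
  shows "a = b \<or> b = c \<or> a = c"
proof (rule ccontr)
  assume "\<not> ?thesis"
  then have "card {a, b, c} = 3" by auto
  moreover have "finite (parcs G `` {u})"
    using pair_finite_arcs by (simp add: finite_Image)
  moreover have "{a, b, c} \<subseteq> parcs G `` {u}" using assms by auto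
  ultimately have "3 \<le> card (parcs G `` {u})" using card_mono by metis
  then show False using assms(1) by simp
qed

text \<open>
  A longest path already covers everything. Otherwise connectedness gives an edge leaving the
  path: at an end of the path it would extend the path, and at an inner vertex it would be a
  third edge.
\<close>

lemma hamiltonian_path_if_degree_le_two:
  assumes G: "pair_graph G" and conn: "Digraph_Component.connected (with_proj G)"
    and deg: "\<And>u. u \<in> pverts G \<Longrightarrow> card (parcs G `` {u}) \<le> 2"
  obtains xs where "distinct xs" "set xs = pverts G" "successively (\<lambda>u v. (u, v) \<in> parcs G) xs"
proof -
  interpret pair_graph G by fact
  define P where "P xs \<longleftrightarrow> xs \<noteq> [] \<and> distinct xs \<and> set xs \<subseteq> pverts G \<and>
    successively (\<lambda>u v. (u, v) \<in> parcs G) xs" for xs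
  obtain x where "x \<in> pverts G"
    using conn by (auto simp: Digraph_Component.connected_def strongly_connected_def)
  then have "P [x]" by (simp add: P_def)
  moreover have "\<forall>xs. P xs \<longrightarrow> length xs < Suc (card (pverts G))"
    using card_mono[OF pair_finite_verts] by (metis P_def distinct_card le_imp_less_Suc)
  ultimately obtain xs where P: "P xs" and max: "\<And>ys. P ys \<Longrightarrow> length ys \<le> length xs"
    using ex_has_greatest_nat[of P "[x]" length] by blast
  have adj: "(xs ! i, xs ! Suc i) \<in> parcs G" if "Suc i < length xs" for i
    using P that by (simp add: P_def successively_conv_nth)
  have "set xs = pverts G"
  proof (rule ccontr)
    assume "set xs \<noteq> pverts G"
    then have "set xs \<subset> pverts G" "set xs \<noteq> {}" using P by (auto simp: P_def)
    then obtain u y where u: "u \<in> set xs" and y: "y \<notin> set xs" and uy: "(u, y) \<in> parcs G"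
      using connected_arc_leaving[OF G conn] by metis
    obtain i where i: "i < length xs" "u = xs ! i" using u by (metis in_set_conv_nth)
    have yV: "y \<in> pverts G" using uy in_arcsD2 by blast
    consider "i = 0" | "Suc i = length xs" | "0 < i" "Suc i < length xs" using i by linarith
    then show False
    proof cases
      case 1
      then have "P (y # xs)"
        using P y yV uy i arcs_symmetric
        by (auto simp: P_def successively_Cons hd_conv_nth)
      then show False using max by fastforce
    next
      case 2
      then have "last xs = u" using P i by (metis P_def diff_Suc_1 last_conv_nth)
      then have "P (xs @ [y])"
        using P y yV uy by (auto simp: P_def successively_append_iff)
      then show False using max by fastforce
    next
      case 3
      then obtain j where j: "i = Suc j" using gr0_implies_Suc by blast
      have "(u, xs ! j) \<in> parcs G" "(u, xs ! Suc i) \<in> parcs G"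
        using adj[of j] adj[of i] arcs_symmetric i j 3 by auto
      then have "xs ! j = xs ! Suc i \<or> xs ! Suc i = y \<or> xs ! j = y"
        using at_most_two_neighbours[OF deg] uy in_arcsD1 by blast
      moreover have "xs ! j \<noteq> xs ! Suc i"
        using P j 3 by (simp add: P_def nth_eq_iff_index_eq)
      ultimately show False using y 3 j by (metis Suc_lessD nth_mem)
    qed
  qed
  then show ?thesis using P by (intro that[of xs]) (auto simp: P_def)
qed

text \<open>
  An inner vertex of the Hamiltonian path already has two neighbours on the path, so a further
  edge can only join the two ends.
\<close>

lemma path_or_cycle_if_hamiltonian_path:
  assumes G: "pair_graph G" and ne: "pverts G \<noteq> {}"
    and deg: "\<And>u. u \<in> pverts G \<Longrightarrow> card (parcs G `` {u}) \<le> 2"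
    and xs: "distinct xs" "set xs = pverts G" "successively (\<lambda>u v. (u, v) \<in> parcs G) xs"
  shows "is_path_of_order G (length xs) \<or> is_cycle_of_order G (length xs)"
proof -
  interpret pair_graph G by fact
  define n where "n = length xs"
  have n: "n \<ge> 1" using ne xs by (cases xs) (auto simp: n_def)
  have adj: "(xs ! i, xs ! Suc i) \<in> parcs G" if "Suc i < n" for i
    using xs that by (simp add: n_def successively_conv_nth)
  have eq: "xs ! i = xs ! j \<longleftrightarrow> i = j" if "i < n" "j < n" for i j
    using xs that by (simp add: n_def nth_eq_iff_index_eq)
  have V: "xs ! i \<in> pverts G" if "i < n" for i
    using xs(2) that by (metis n_def nth_mem)
  have chord: "j = Suc i \<or> i = 0 \<and> Suc j = n"
    if ij: "i < j" "j < n" "(xs ! i, xs ! j) \<in> parcs G" for i j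
  proof (rule ccontr)
    assume neg: "\<not> ?thesis"
    show False
    proof (cases i)
      case (Suc k)
      have "(xs ! i, xs ! k) \<in> parcs G" "(xs ! i, xs ! Suc i) \<in> parcs G"
        using adj[of k] adj[of i] arcs_symmetric Suc ij by auto
      then have "k = Suc i \<or> Suc i = j \<or> k = j"
        using at_most_two_neighbours[OF deg[OF V[of i]], of "xs ! k" "xs ! Suc i" "xs ! j"] ij Suc
        by (simp add: eq)
      then show False using neg ij Suc by auto
    next
      case 0
      obtain k where k: "j = Suc k" using ij by (cases j) auto
      have "(xs ! j, xs ! k) \<in> parcs G" "(xs ! j, xs ! Suc j) \<in> parcs G"
          "(xs ! j, xs ! i) \<in> parcs G" and "Suc j < n"
        using adj[of k] adj[of j] arcs_symmetric k ij neg 0 by auto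
      then have "k = Suc j \<or> Suc j = i \<or> k = i"
        using at_most_two_neighbours[OF deg[OF V[of j]], of "xs ! k" "xs ! Suc j" "xs ! i"] ij k
        by (simp add: eq)
      then show False using neg ij k by auto
    qed
  qed
  \<comment> \<open>The vertices of path and cycle graphs are numbered from 1, list positions from 0.\<close>
  define f where "f i = xs ! (i - 1)" for i
  have bij: "bij_betw f {1..n} (pverts G)"
  proof (rule bij_betw_imageI)
    show "inj_on f {1..n}" by (rule inj_onI) (auto simp: f_def eq)
    have "f ` {1..n} = f ` (Suc ` {..<n})"
      by (simp add: image_Suc_lessThan)
    also have "\<dots> = set xs"
      by (auto simp: image_image f_def n_def set_conv_nth)
    finally show "f ` {1..n} = pverts G" using xs(2) by simp
  qed
  have isoI: "digraph_iso (with_proj G) (with_proj H)"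
    if H: "pair_wf_digraph H" "pverts H = {1..n}"
      and arcs: "\<And>u v. 1 \<le> u \<Longrightarrow> u < v \<Longrightarrow> v \<le> n \<Longrightarrow> (u, v) \<in> parcs H \<longleftrightarrow> (f u, f v) \<in> parcs G"
      and sym: "\<And>u v. (u, v) \<in> parcs H \<longleftrightarrow> (v, u) \<in> parcs H" "\<And>u. (u, u) \<notin> parcs H"
    for H :: "nat pair_pre_digraph"
  proof -
    have "(u, v) \<in> parcs H \<longleftrightarrow> (f u, f v) \<in> parcs G" if "u \<in> {1..n}" "v \<in> {1..n}" for u v
    proof (cases u v rule: linorder_cases)
      case greater
      then show ?thesis using arcs[of v u] sym arcs_symmetric that by (meson atLeastAtMost_iff)
    next
      case equal
      then show ?thesis using sym(2) no_loops' by blast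
    qed (use that arcs in auto)
    then have "digraph_iso (with_proj H) (with_proj G)"
      using bij H by (auto simp: digraph_iso_with_proj_iff pair_wf_digraph)
    then show ?thesis using H digraph_iso_with_proj_sym by blast
  qed
  have arcs: "(f u, f v) \<in> parcs G \<longleftrightarrow> v = Suc u \<or> u = 1 \<and> v = n \<and> (f 1, f n) \<in> parcs G"
    if uv: "1 \<le> u" "u < v" "v \<le> n" for u v
  proof -
    obtain i j where "u = Suc i" "v = Suc j"
      using uv by (cases u; cases v) auto
    then show ?thesis using uv adj[of i] chord[of i j] by (auto simp: f_def)
  qed
  show ?thesis
  proof (cases "n \<ge> 3 \<and> (f 1, f n) \<in> parcs G")
    case True
    have "digraph_iso (with_proj G) (with_proj (cycle_graph n))"
    proof (rule isoI)
      show "pair_wf_digraph (cycle_graph n)"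
        using True pair_graph_cycle_graph pair_graph_imp_pair_wf_digraph by blast
      show "(u, v) \<in> parcs (cycle_graph n) \<longleftrightarrow> (f u, f v) \<in> parcs G"
        if "1 \<le> u" "u < v" "v \<le> n" for u v
        unfolding arcs[OF that] using True that by (simp add: cycle_graph_def path_graph_def) linarith
      show "(u, v) \<in> parcs (cycle_graph n) \<longleftrightarrow> (v, u) \<in> parcs (cycle_graph n)" for u v
        by (simp add: cycle_graph_def path_graph_def) blast
      show "(u, u) \<notin> parcs (cycle_graph n)" for u
        using True by (simp add: cycle_graph_def path_graph_def)
    qed (simp add: cycle_graph_def)
    then show ?thesis using True by (simp add: is_cycle_of_order_def n_def)
  next
    case False
    have "digraph_iso (with_proj G) (with_proj (path_graph n))"
    proof (rule isoI)
      show "pair_wf_digraph (path_graph n)"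
        using pair_graph_path_graph pair_graph_imp_pair_wf_digraph by blast
      show "(u, v) \<in> parcs (path_graph n) \<longleftrightarrow> (f u, f v) \<in> parcs G"
        if "1 \<le> u" "u < v" "v \<le> n" for u v
        unfolding arcs[OF that] using False that by (simp add: path_graph_def) linarith
      show "(u, v) \<in> parcs (path_graph n) \<longleftrightarrow> (v, u) \<in> parcs (path_graph n)" for u v
        by (simp add: path_graph_def) blast
      show "(u, u) \<notin> parcs (path_graph n)" for u
        by (simp add: path_graph_def)
    qed (simp add: path_graph_def)
    then show ?thesis using n by (simp add: is_path_of_order_def n_def)
  qed
qed

section \<open>Rows and columns of the matrix\<close>

definition row_support :: "nat \<Rightarrow> (nat \<Rightarrow> nat \<Rightarrow> nat) \<Rightarrow> nat \<Rightarrow> nat set" where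
  "row_support n T u = {k \<in> {1..n}. T u k = 1}"

definition col_support :: "nat \<Rightarrow> (nat \<Rightarrow> nat \<Rightarrow> nat) \<Rightarrow> nat \<Rightarrow> nat set" where
  "col_support n T k = {u \<in> {1..n}. T u k = 1}"

lemma finite_supports [simp]: "finite (row_support n T u)" "finite (col_support n T k)"
  by (auto simp: row_support_def col_support_def)

text \<open>Rows with a one in a common column are pairwise adjacent.\<close>

lemma card_col_support_le_two:
  assumes "triangle_free (row_graph n T)" "k \<in> {1..n}"
  shows "card (col_support n T k) \<le> 2"
proof (rule ccontr)
  assume "\<not> ?thesis"
  then have "3 \<le> card (col_support n T k)" by simp
  then obtain S where S: "S \<subseteq> col_support n T k" "card S = 3"
    using obtain_subset_with_card_n by metis
  then obtain u v w where "S = {u, v, w}" "u \<noteq> v" "v \<noteq> w" "u \<noteq> w"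
    by (metis card_3_iff)
  moreover have "(x, y) \<in> parcs (row_graph n T)" if "x \<in> S" "y \<in> S" "x \<noteq> y" for x y
    using that S(1) assms(2) by (auto simp: row_graph_def col_support_def)
  ultimately show False
    using assms(1) unfolding triangle_free_def by blast
qed

text \<open>
  A neighbour of \<open>u\<close> is the other row of some column in which \<open>u\<close> has a one, and each such
  column has at most one other row.
\<close>

lemma degree_le_card_row_support:
  assumes col: "\<And>k. k \<in> {1..n} \<Longrightarrow> card (col_support n T k) \<le> 2"
  shows "card (parcs (row_graph n T) `` {u}) \<le> card (row_support n T u)"
proof (cases "u \<in> {1..n}")
  case True
  have "parcs (row_graph n T) `` {u} \<subseteq> (\<Union>k\<in>row_support n T u. col_support n T k - {u})"
    by (auto simp: row_graph_def row_support_def col_support_def)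
  then have "card (parcs (row_graph n T) `` {u})
      \<le> card (\<Union>k\<in>row_support n T u. col_support n T k - {u})"
    by (intro card_mono) auto
  also have "\<dots> \<le> (\<Sum>k\<in>row_support n T u. card (col_support n T k - {u}))"
    by (intro card_UN_le) auto
  also have "\<dots> \<le> (\<Sum>k\<in>row_support n T u. 1)"
  proof (rule sum_mono)
    fix k assume "k \<in> row_support n T u"
    then have "u \<in> col_support n T k" "k \<in> {1..n}"
      using True by (auto simp: row_support_def col_support_def)
    then show "card (col_support n T k - {u}) \<le> 1" using col[of k] by simp
  qed
  finally show ?thesis by simp
next
  case False
  then have "parcs (row_graph n T) `` {u} = {}" by (auto simp: row_graph_def)
  then show ?thesis by simp
qed

lemma toeplitz01_eq_1_iff:
  "toeplitz01 \<alpha> \<beta> u k = 1 \<longleftrightarrow> (\<exists>a\<in>\<alpha>. u = k + a) \<or> (\<exists>b\<in>\<beta>. k = u + b)"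
proof -
  have "int u - int k \<in> int ` \<alpha> \<longleftrightarrow> (\<exists>a\<in>\<alpha>. u = k + a)" by force
  moreover have "int k - int u \<in> int ` \<beta> \<longleftrightarrow> (\<exists>b\<in>\<beta>. k = u + b)" by force
  ultimately show ?thesis by (simp add: toeplitz01_def)
qed

text \<open>
  Reflection about the antidiagonal maps \<open>(u, k)\<close> to \<open>(n + 1 - k, n + 1 - u)\<close>, which preserves
  the difference of row and column index, and a Toeplitz entry depends only on this difference.
\<close>

lemma toeplitz01_persymmetric:
  assumes "u \<le> n" "k \<le> n"
  shows "toeplitz01 \<alpha> \<beta> (Suc n - k) (Suc n - u) = toeplitz01 \<alpha> \<beta> u k"
  using assms by (simp add: toeplitz01_def)

lemma card_row_support_toeplitz01:
  assumes "u \<in> {1..n}"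
  shows "card (row_support n (toeplitz01 \<alpha> \<beta>) u) = card (col_support n (toeplitz01 \<alpha> \<beta>) (Suc n - u))"
proof (rule bij_betw_same_card)
  show "bij_betw (\<lambda>k. Suc n - k)
      (row_support n (toeplitz01 \<alpha> \<beta>) u) (col_support n (toeplitz01 \<alpha> \<beta>) (Suc n - u))"
    using assms toeplitz01_persymmetric[of u n _ \<alpha> \<beta>]
      toeplitz01_persymmetric[of _ n "Suc n - u" \<alpha> \<beta>]
    by (intro bij_betw_byWitness[where f' = "\<lambda>k. Suc n - k"])
      (auto simp: row_support_def col_support_def)
qed

text \<open>
  If \<open>j\<close> were in both supports, then the difference of \<open>k\<close> and \<open>j\<close> would lie in both \<open>\<alpha>\<close> and
  \<open>\<beta>\<close>. So the supports are disjoint, and neither contains \<open>k\<close> because the diagonal is zero.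
\<close>

lemma card_row_support_add_card_col_support:
  assumes "\<alpha> \<subseteq> {1..n - 1}" "\<beta> \<subseteq> {1..n - 1}" "\<alpha> \<inter> \<beta> = {}" and k: "k \<in> {1..n}"
  shows "card (row_support n (toeplitz01 \<alpha> \<beta>) k) + card (col_support n (toeplitz01 \<alpha> \<beta>) k) \<le> n - 1"
    (is "card ?R + card ?C \<le> _")
proof -
  have 0: "0 \<notin> \<alpha>" "0 \<notin> \<beta>" using assms by auto
  have "?R \<inter> ?C = {}"
    using assms(3) 0 unfolding row_support_def col_support_def toeplitz01_eq_1_iff by fastforce
  then have "card ?R + card ?C = card (?R \<union> ?C)" by (simp add: card_Un_disjoint)
  also have "\<dots> \<le> card ({1..n} - {k})"
    using 0 unfolding row_support_def col_support_def toeplitz01_eq_1_iff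
    by (intro card_mono) auto
  also have "\<dots> = n - 1" using k by simp
  finally show ?thesis .
qed

section \<open>The order is at least five\<close>

text \<open>
  Every edge of the Hamiltonian path \<open>xs\<close> comes from a column, whose support is then exactly the
  pair of ends of that edge; so different edges come from different columns.
\<close>

lemma many_full_columns:
  assumes col: "\<And>k. k \<in> {1..n} \<Longrightarrow> card (col_support n T k) \<le> 2"
    and xs: "distinct xs" "set xs = {1..n}"
      "successively (\<lambda>u v. (u, v) \<in> parcs (row_graph n T)) xs"
  shows "n - 1 \<le> card {k \<in> {1..n}. card (col_support n T k) = 2}"
proof -
  have len: "length xs = n" using xs distinct_card by fastforce
  have "\<exists>k\<in>{1..n}. {xs ! i, xs ! Suc i} \<subseteq> col_support n T k" if "i < n - 1" for i
    using xs(3) that len by (auto simp: successively_conv_nth row_graph_def col_support_def)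
  then obtain c where c: "\<And>i. i < n - 1 \<Longrightarrow> c i \<in> {1..n}"
    "\<And>i. i < n - 1 \<Longrightarrow> {xs ! i, xs ! Suc i} \<subseteq> col_support n T (c i)"
    by metis
  have two: "card {xs ! i, xs ! Suc i} = 2" if "i < n - 1" for i
    using xs(1) that len by (simp add: nth_eq_iff_index_eq)
  have C: "col_support n T (c i) = {xs ! i, xs ! Suc i}" if "i < n - 1" for i
    using card_seteq[OF _ c(2)[OF that]] col[OF c(1)[OF that]] two[OF that] by simp
  have "inj_on c {..<n - 1}"
  proof (rule inj_onI)
    fix i j assume ij: "i \<in> {..<n - 1}" "j \<in> {..<n - 1}" "c i = c j"
    then have "{xs ! i, xs ! Suc i} = {xs ! j, xs ! Suc j}" using C by (metis lessThan_iff)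
    then show "i = j"
      using xs(1) ij len by (auto simp: doubleton_eq_iff nth_eq_iff_index_eq)
  qed
  moreover have "c ` {..<n - 1} \<subseteq> {k \<in> {1..n}. card (col_support n T k) = 2}"
    using c(1) C two by auto
  ultimately have "card {..<n - 1} \<le> card {k \<in> {1..n}. card (col_support n T k) = 2}"
    by (intro card_inj_on_le) auto
  then show ?thesis by simp
qed

text \<open>
  Two sets of at least \<open>n - 1\<close> out of \<open>n\<close> indices, those of the columns and those of the
  rows with two ones, meet as soon as \<open>n \<ge> 3\<close>; at a common index \<open>k\<close> the row and the column need four indices besides \<open>k\<close>.
\<close>

lemma order_ge_five:
  assumes \<alpha>\<beta>: "\<alpha> \<subseteq> {1..n - 1}" "\<beta> \<subseteq> {1..n - 1}" "\<alpha> \<inter> \<beta> = {}" and n: "n \<ge> 2"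
    and full: "n - 1 \<le> card {k \<in> {1..n}. card (col_support n (toeplitz01 \<alpha> \<beta>) k) = 2}"
  shows "n \<ge> 5"
proof -
  let ?C = "col_support n (toeplitz01 \<alpha> \<beta>)" and ?R = "row_support n (toeplitz01 \<alpha> \<beta>)"
  let ?A = "{k \<in> {1..n}. card (?C k) = 2}" and ?B = "{k \<in> {1..n}. card (?R k) = 2}"
  have bound: "card (?R k) + card (?C k) \<le> n - 1" if "k \<in> {1..n}" for k
    using card_row_support_add_card_col_support[OF \<alpha>\<beta> that] .
  have "card ?A \<noteq> 0" using full n by linarith
  then have "?A \<noteq> {}" by (metis card.empty)
  then obtain k where "k \<in> {1..n}" "card (?C k) = 2" by auto
  then have n3: "n \<ge> 3" using bound[of k] by auto
  have "card (?R (Suc n - k)) = card (?C k)" if "k \<in> {1..n}" for k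
  proof -
    have "Suc n - k \<in> {1..n}" "Suc n - (Suc n - k) = k" using that by auto
    then show ?thesis using card_row_support_toeplitz01 by metis
  qed
  then have "bij_betw (\<lambda>k. Suc n - k) ?A ?B"
    using card_row_support_toeplitz01[of _ n \<alpha> \<beta>]
    by (intro bij_betw_byWitness[where f' = "\<lambda>k. Suc n - k"]) auto
  then have "card ?B = card ?A" by (rule bij_betw_same_card[symmetric])
  moreover have "card ?A + card ?B = card (?A \<union> ?B) + card (?A \<inter> ?B)"
    by (intro card_Un_Int) auto
  moreover have "card (?A \<union> ?B) \<le> n"
  proof -
    have "?A \<union> ?B \<subseteq> {1..n}" by blast
    then have "card (?A \<union> ?B) \<le> card {1..n}" by (rule card_mono[OF finite_atLeastAtMost])
    then show ?thesis by (simp only: card_atLeastAtMost diff_Suc_1 One_nat_def)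
  qed
  ultimately have "card (?A \<inter> ?B) \<noteq> 0" using full n3 by linarith
  then have "?A \<inter> ?B \<noteq> {}" by (metis card.empty)
  then obtain k where "k \<in> {1..n}" "card (?C k) = 2" "card (?R k) = 2" by auto
  then show ?thesis using bound[of k] by simp
qed

lemma connected_triangle_free_toeplitz_row_graph:
  assumes \<alpha>\<beta>: "\<alpha> \<subseteq> {1..n - 1}" "\<beta> \<subseteq> {1..n - 1}" "\<alpha> \<inter> \<beta> = {}" and n: "n \<ge> 2"
    and R: "R = row_graph n (toeplitz01 \<alpha> \<beta>)"
    and conn: "Digraph_Component.connected (with_proj R)" and free: "triangle_free R"
  shows "n \<ge> 5 \<and> (is_path_of_order R n \<or> is_cycle_of_order R n)"
proof -
  let ?T = "toeplitz01 \<alpha> \<beta>"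
  have pg: "pair_graph R" using R pair_graph_row_graph by simp
  have V: "pverts R = {1..n}" by (simp add: R row_graph_def)
  have col: "card (col_support n ?T k) \<le> 2" if "k \<in> {1..n}" for k
    using free R that by (intro card_col_support_le_two) auto
  have deg: "card (parcs R `` {u}) \<le> 2" if "u \<in> pverts R" for u
  proof -
    have "card (parcs R `` {u}) \<le> card (row_support n ?T u)"
      unfolding R by (intro degree_le_card_row_support col)
    also have "\<dots> = card (col_support n ?T (Suc n - u))"
      using that V by (intro card_row_support_toeplitz01) simp
    also have "\<dots> \<le> 2" using that V by (intro col) auto
    finally show ?thesis .
  qed
  obtain xs where xs: "distinct xs" "set xs = pverts R"
      "successively (\<lambda>u v. (u, v) \<in> parcs R) xs"
    using hamiltonian_path_if_degree_le_two[OF pg conn deg] by metis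
  have "length xs = n" using xs V distinct_card by fastforce
  then have "is_path_of_order R n \<or> is_cycle_of_order R n"
    using path_or_cycle_if_hamiltonian_path[OF pg _ deg xs] V n by auto
  moreover have "n \<ge> 5"
    using xs V unfolding R by (intro order_ge_five[OF \<alpha>\<beta> n] many_full_columns col) auto
  ultimately show ?thesis by simp
qed

theorem theorem2p14:
  fixes G :: "'a pair_pre_digraph" and n :: nat
  assumes "pair_graph G" and "toeplitz_row_graph G" and "card (pverts G) = n"
  shows "Digraph_Component.connected (with_proj G) \<and> triangle_free G \<longleftrightarrow>
           n \<ge> 5 \<and> (is_path_of_order G n \<or> is_cycle_of_order G n)"
proof
  obtain m \<alpha> \<beta> where \<alpha>\<beta>: "\<alpha> \<subseteq> {1..m - 1}" "\<beta> \<subseteq> {1..m - 1}" "\<alpha> \<inter> \<beta> = {}"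
      "\<not> (\<alpha> = {} \<and> \<beta> = {})"
    and iso: "digraph_iso (with_proj G) (with_proj (row_graph m (toeplitz01 \<alpha> \<beta>)))"
    using assms(2) unfolding toeplitz_row_graph_def by metis
  define R where "R = row_graph m (toeplitz01 \<alpha> \<beta>)"
  have wfG: "pair_wf_digraph G" and wfR: "pair_wf_digraph R"
    using assms(1) pair_graph_row_graph pair_graph_imp_pair_wf_digraph unfolding R_def by blast+
  have iso: "digraph_iso (with_proj G) (with_proj R)" using iso R_def by simp
  then obtain f where "bij_betw f (pverts G) (pverts R)"
    using digraph_iso_with_proj_iff[OF wfG wfR] by blast
  then have "m = n"
    using assms(3) bij_betw_same_card by (fastforce simp: R_def row_graph_def)
  have "m \<ge> 2"
  proof (rule ccontr)
    assume "\<not> ?thesis"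
    then have "{1..m - 1} = {}" by auto
    then show False using \<alpha>\<beta> by auto
  qed
  assume "Digraph_Component.connected (with_proj G) \<and> triangle_free G"
  then have "Digraph_Component.connected (with_proj R)" "triangle_free R"
    using iso wfG wfR connected_iso triangle_free_iso digraph_iso_with_proj_sym by metis+
  then have R: "n \<ge> 5 \<and> (is_path_of_order R n \<or> is_cycle_of_order R n)"
    using connected_triangle_free_toeplitz_row_graph[OF \<alpha>\<beta>(1-3) \<open>m \<ge> 2\<close> R_def] \<open>m = n\<close> by blast
  moreover have "pair_wf_digraph (path_graph n)" "pair_wf_digraph (cycle_graph n)"
    using R pair_graph_path_graph pair_graph_cycle_graph[of n] pair_graph_imp_pair_wf_digraph
    by auto
  ultimately show "n \<ge> 5 \<and> (is_path_of_order G n \<or> is_cycle_of_order G n)"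
    using digraph_iso_with_proj_trans[OF wfG wfR _ iso]
    unfolding is_path_of_order_def is_cycle_of_order_def by blast
next
  assume "n \<ge> 5 \<and> (is_path_of_order G n \<or> is_cycle_of_order G n)"
  then show "Digraph_Component.connected (with_proj G) \<and> triangle_free G"
    using connected_triangle_free_if_path_or_cycle[OF assms(1), of n] by simp
qed

end
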